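(* The sequent calculus $\mathtt{CHC}$ admits cut elimination: every sequent derivable in $\mathtt{CHC}$ (from no assumptions) has a derivation in $\mathtt{CHC}$ that does not use the rule (cut).
   Context: Formulas are built from variables with binary $\wedge,\vee,\rightarrow$ and constants $0,1$; $\neg\alpha:=\alpha\rightarrow 0$. A sequent $\Gamma\blacktriangleright\Pi$ is a pair of a finite set $\Gamma$ of formulas and a set $\Pi$ (the stoup) that is empty or a singleton; commas denote union. The calculus $\mathtt{CHC}$ has axioms (id) $\alpha\blacktriangleright\alpha$; (0) $0\blacktriangleright$; (1) $\blacktriangleright 1$; structural rules (w-l) from $\Gamma\blacktriangleright\Pi$ infer $\alpha,\Gamma\blacktriangleright\Pi$; (w-r) from $\Gamma\blacktriangleright$ infer $\Gamma\blacktriangleright\alpha$; (cut) from $\Gamma\blacktriangleright\alpha$ and $\alpha,\Delta\blacktriangleright\Pi$ infer $\Gamma,\Delta\blacktriangleright\Pi$; and operational rules ($\wedge$-l) from $\alpha,\Gamma\blacktriangleright\Pi$ (or from $\beta,\Gamma\blacktriangleright\Pi$) infer $\alpha\wedge\beta,\Gamma\blacktriangleright\Pi$; ($\wedge$-r) from $\Gamma\blacktriangleright\alpha$ and $\Gamma\blacktriangleright\beta$ infer $\Gamma\blacktriangleright\alpha\wedge\beta$; ($\vee$-r) from $\Gamma\blacktriangleright\alpha$ (or from $\Gamma\blacktriangleright\beta$) infer $\Gamma\blacktriangleright\alpha\vee\beta$; ($\vee$-l) from $\alpha,\Gamma\blacktriangleright\Pi$ and $\beta,\Gamma\blacktriangleright\Pi$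 infer $\alpha\vee\beta,\Gamma\blacktriangleright\Pi$; ($\rightarrow$-l(a)) from $\Gamma\blacktriangleright\alpha$ and $\Delta,\beta\blacktriangleright\Pi$ infer $\Delta,\Gamma,\alpha\rightarrow\beta\blacktriangleright\Pi$; ($\rightarrow$-l(b)) from $\neg\alpha,\Gamma\blacktriangleright\beta$ and $\Delta,\alpha,\beta\blacktriangleright$ infer $\Gamma,\Delta,\alpha\rightarrow\beta\blacktriangleright$; ($\rightarrow$-r) from $\alpha,\Gamma\blacktriangleright\beta$ and $\Delta,\neg\alpha,\beta\blacktriangleright$ infer $\Gamma,\Delta\blacktriangleright\alpha\rightarrow\beta$. *)

theory Defs
  imports "HOL-Library.FSet"
begin

datatype 'v fm =
    Var 'v
  | Zero
  | One
  | Conj "'v fm" "'v fm"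
  | Disj "'v fm" "'v fm"
  | Imp "'v fm" "'v fm"

abbreviation Neg :: "'v fm \<Rightarrow> 'v fm" where
  "Neg \<alpha> \<equiv> Imp \<alpha> Zero"

text \<open>
  A sequent is given by a finite set of formulas and a stoup, where \<open>None\<close> is the empty
  stoup and \<open>Some \<alpha>\<close> the singleton one. The Boolean parameter of \<open>CHC\<close> tells whether (cut)
  may be used in the derivation; no other rule depends on it. The context of a premise may
  already contain the active formula, since commas denote union of sets.
\<close>

inductive CHC :: "bool \<Rightarrow> 'v fm fset \<Rightarrow> 'v fm option \<Rightarrow> bool" for cut_allowed :: bool where
  ax_id: "CHC cut_allowed {|\<alpha>|} (Some \<alpha>)"
| ax_zero: "CHC cut_allowed {|Zero|} None"
| ax_one: "CHC cut_allowed {||} (Some One)"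
| weak_l: "CHC cut_allowed \<Gamma> \<Pi> \<Longrightarrow> CHC cut_allowed (finsert \<alpha> \<Gamma>) \<Pi>"
| weak_r: "CHC cut_allowed \<Gamma> None \<Longrightarrow> CHC cut_allowed \<Gamma> (Some \<alpha>)"
| cut: "\<lbrakk>cut_allowed; CHC cut_allowed \<Gamma> (Some \<alpha>); CHC cut_allowed (finsert \<alpha> \<Delta>) \<Pi>\<rbrakk>
    \<Longrightarrow> CHC cut_allowed (\<Gamma> |\<union>| \<Delta>) \<Pi>"
| conj_l1: "CHC cut_allowed (finsert \<alpha> \<Gamma>) \<Pi> \<Longrightarrow> CHC cut_allowed (finsert (Conj \<alpha> \<beta>) \<Gamma>) \<Pi>"
| conj_l2: "CHC cut_allowed (finsert \<beta> \<Gamma>) \<Pi> \<Longrightarrow> CHC cut_allowed (finsert (Conj \<alpha> \<beta>) \<Gamma>) \<Pi>"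
| conj_r: "\<lbrakk>CHC cut_allowed \<Gamma> (Some \<alpha>); CHC cut_allowed \<Gamma> (Some \<beta>)\<rbrakk>
    \<Longrightarrow> CHC cut_allowed \<Gamma> (Some (Conj \<alpha> \<beta>))"
| disj_r1: "CHC cut_allowed \<Gamma> (Some \<alpha>) \<Longrightarrow> CHC cut_allowed \<Gamma> (Some (Disj \<alpha> \<beta>))"
| disj_r2: "CHC cut_allowed \<Gamma> (Some \<beta>) \<Longrightarrow> CHC cut_allowed \<Gamma> (Some (Disj \<alpha> \<beta>))"
| disj_l: "\<lbrakk>CHC cut_allowed (finsert \<alpha> \<Gamma>) \<Pi>; CHC cut_allowed (finsert \<beta> \<Gamma>) \<Pi>\<rbrakk>
    \<Longrightarrow> CHC cut_allowed (finsert (Disj \<alpha> \<beta>) \<Gamma>) \<Pi>"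
| imp_la: "\<lbrakk>CHC cut_allowed \<Gamma> (Some \<alpha>); CHC cut_allowed (finsert \<beta> \<Delta>) \<Pi>\<rbrakk>
    \<Longrightarrow> CHC cut_allowed (finsert (Imp \<alpha> \<beta>) (\<Delta> |\<union>| \<Gamma>)) \<Pi>"
| imp_lb: "\<lbrakk>CHC cut_allowed (finsert (Neg \<alpha>) \<Gamma>) (Some \<beta>);
     CHC cut_allowed (finsert \<alpha> (finsert \<beta> \<Delta>)) None\<rbrakk>
    \<Longrightarrow> CHC cut_allowed (finsert (Imp \<alpha> \<beta>) (\<Gamma> |\<union>| \<Delta>)) None"
| imp_r: "\<lbrakk>CHC cut_allowed (finsert \<alpha> \<Gamma>) (Some \<beta>);
     CHC cut_allowed (finsert (Neg \<alpha>) (finsert \<beta> \<Delta>)) None\<rbrakk>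
    \<Longrightarrow> CHC cut_allowed (\<Gamma> |\<union>| \<Delta>) (Some (Imp \<alpha> \<beta>))"

abbreviation CHC_derivable :: "'v fm fset \<Rightarrow> 'v fm option \<Rightarrow> bool" where
  "CHC_derivable \<equiv> CHC True"

abbreviation CHC_cut_free :: "'v fm fset \<Rightarrow> 'v fm option \<Rightarrow> bool" where
  "CHC_cut_free \<equiv> CHC False"

end

theory Submission
  imports Defs
begin

text \<open>
  Cut is shown admissible by induction on a weight of the cut formula. A cut is first permuted
  up the left derivation until its formula is principal there, then up the right one. The only
  unusual reduction is (imp-r) against (imp-lb): two cuts on \<open>\<beta>\<close> produce \<open>\<dots> \<turnstile> \<not>\<alpha>\<close> and
  \<open>\<not>\<alpha>, \<dots> \<turnstile>\<close>, so a cut on \<open>\<not>\<alpha>\<close> remains, which is not a subformula of \<open>\<alpha> \<rightarrow> \<beta>\<close>. Giving \<open>0\<close>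
  weight zero makes \<open>\<not>\<alpha>\<close> lighter than \<open>\<alpha> \<rightarrow> \<beta>\<close> unless \<open>\<beta> = 0\<close>, and in that case the cut
  on \<open>\<not>\<alpha>\<close> is one against a premise of (imp-lb), available from the inner induction.
\<close>

fun weight :: "'v fm \<Rightarrow> nat" where
  "weight (Var v) = 1"
| "weight Zero = 0"
| "weight One = 1"
| "weight (Conj a b) = Suc (weight a + weight b)"
| "weight (Disj a b) = Suc (weight a + weight b)"
| "weight (Imp a b) = Suc (weight a + weight b)"

lemma weight_eq_0_iff [simp]: "weight a = 0 \<longleftrightarrow> a = Zero"
  by (cases a) auto

section \<open>Weakening and rules with a shared context\<close>

lemma weakening_left:
  assumes "CHC c \<Gamma> \<Pi>" and "\<Gamma> |\<subseteq>| \<Delta>"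
  shows "CHC c \<Delta> \<Pi>"
proof -
  have "CHC c (\<Delta>' |\<union>| \<Gamma>) \<Pi>" for \<Delta>'
    by (induction \<Delta>') (auto intro: assms(1) CHC.weak_l)
  from this[of \<Delta>] show ?thesis
    using assms(2) by (simp add: sup.absorb1)
qed

lemma weakening_right: "CHC c \<Gamma> None \<Longrightarrow> CHC c \<Gamma> \<Pi>"
  by (cases \<Pi>) (auto intro: CHC.weak_r)

text \<open>No right rule introduces \<open>Zero\<close>, so it enters the stoup only through
  \<open>ax_id\<close>, which \<open>ax_zero\<close> replaces, or through \<open>weak_r\<close>,
  which is dropped; left rules carry the change down.\<close>

lemma stoup_Zero_elim:
  fixes \<Gamma> :: "'v fm fset"
  assumes "CHC False \<Gamma> (Some Zero)"
  shows "CHC False \<Gamma> None"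
  using assms
  by (induction \<Gamma> "Some Zero :: 'v fm option" rule: CHC.induct) (auto intro: CHC.intros)

lemma imp_la_same_context:
  assumes "CHC c \<Gamma> (Some a)" and "CHC c (finsert b \<Gamma>) \<Pi>"
  shows "CHC c (finsert (Imp a b) \<Gamma>) \<Pi>"
  using CHC.imp_la[OF assms] by simp

lemma imp_lb_same_context:
  assumes "CHC c (finsert (Neg a) \<Gamma>) (Some b)" and "CHC c (finsert a (finsert b \<Gamma>)) None"
  shows "CHC c (finsert (Imp a b) \<Gamma>) None"
  using CHC.imp_lb[OF assms] by simp

lemma imp_r_same_context:
  assumes "CHC c (finsert a \<Gamma>) (Some b)" and "CHC c (finsert (Neg a) (finsert b \<Gamma>)) None"
  shows "CHC c \<Gamma> (Some (Imp a b))"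
  using CHC.imp_r[OF assms] by simp

text \<open>The second premise of \<open>imp_r\<close> is free here, since it has
  \<open>Zero\<close> on the left.\<close>

lemma Neg_right:
  assumes "CHC c (finsert a \<Gamma>) None"
  shows "CHC c \<Gamma> (Some (Neg a))"
proof (rule imp_r_same_context)
  show "CHC c (finsert a \<Gamma>) (Some Zero)"
    by (rule CHC.weak_r[OF assms])
  show "CHC c (finsert (Neg a) (finsert Zero \<Gamma>)) None"
    by (rule weakening_left[OF CHC.ax_zero]) auto
qed

section \<open>Reducing a cut to cuts on lighter formulas\<close>

definition cut_admissible :: "'v fm \<Rightarrow> bool" where
  "cut_admissible \<gamma> \<longleftrightarrow> (\<forall>\<Gamma> \<Pi>. CHC False \<Gamma> (Some \<gamma>) \<longrightarrow>
     CHC False (finsert \<gamma> \<Gamma>) \<Pi> \<longrightarrow> CHC False \<Gamma> \<Pi>)"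

text \<open>Weakening brings both premises to the common context \<Theta>, so the one-context form
  of \<open>cut_admissible\<close> loses no generality.\<close>

lemma cut_admissibleD:
  assumes "cut_admissible \<gamma>" and "CHC False \<Gamma> (Some \<gamma>)" and "CHC False (finsert \<gamma> \<Delta>) \<Pi>"
    and "\<Gamma> |\<subseteq>| \<Theta>" and "\<Delta> |\<subseteq>| \<Theta>"
  shows "CHC False \<Theta> \<Pi>"
proof -
  have "CHC False \<Theta> (Some \<gamma>)" and "CHC False (finsert \<gamma> \<Theta>) \<Pi>"
    using assms(2-5) by (auto elim!: weakening_left)
  with assms(1) show ?thesis
    unfolding cut_admissible_def by blast
qed

text \<open>
  The hypotheses \<open>conj\<close>, \<open>disj\<close>, \<open>imp_a\<close>, \<open>imp_b\<close> say that \<open>\<Gamma>\<close> can replace \<open>\<gamma>\<close> below a left rule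
  in which \<open>\<gamma>\<close> is principal and no longer occurs in the premises.
\<close>

lemma cut_permute_right:
  assumes "CHC False \<Delta> \<Pi>"
    and left: "CHC False \<Gamma> (Some \<gamma>)"
    and nonzero: "\<gamma> \<noteq> Zero"
    and conj: "\<And>a b \<Delta> \<Pi>. \<gamma> = Conj a b \<Longrightarrow> \<Gamma> |\<subseteq>| \<Delta> \<Longrightarrow>
      CHC False (finsert a \<Delta>) \<Pi> \<or> CHC False (finsert b \<Delta>) \<Pi> \<Longrightarrow> CHC False \<Delta> \<Pi>"
    and disj: "\<And>a b \<Delta> \<Pi>. \<gamma> = Disj a b \<Longrightarrow> \<Gamma> |\<subseteq>| \<Delta> \<Longrightarrow>
      CHC False (finsert a \<Delta>) \<Pi> \<Longrightarrow> CHC False (finsert b \<Delta>) \<Pi> \<Longrightarrow> CHC False \<Delta> \<Pi>"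
    and imp_a: "\<And>a b \<Delta> \<Pi>. \<gamma> = Imp a b \<Longrightarrow> \<Gamma> |\<subseteq>| \<Delta> \<Longrightarrow>
      CHC False \<Delta> (Some a) \<Longrightarrow> CHC False (finsert b \<Delta>) \<Pi> \<Longrightarrow> CHC False \<Delta> \<Pi>"
    and imp_b: "\<And>a b \<Delta>. \<gamma> = Imp a b \<Longrightarrow> b \<noteq> Zero \<Longrightarrow> \<Gamma> |\<subseteq>| \<Delta> \<Longrightarrow>
      CHC False (finsert (Neg a) \<Delta>) (Some b) \<Longrightarrow>
      CHC False (finsert a (finsert b \<Delta>)) None \<Longrightarrow> CHC False \<Delta> None"
  shows "CHC False (\<Gamma> |\<union>| (\<Delta> |-| {|\<gamma>|})) \<Pi>"
  using assms(1)
proof (induction rule: CHC.induct)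
  case (ax_id \<alpha>)
  show ?case
  proof (cases "\<alpha> = \<gamma>")
    case True
    then show ?thesis using left by simp
  next
    case False
    then show ?thesis by (intro weakening_left[OF CHC.ax_id]) auto
  qed
next
  case ax_zero
  show ?case
    \<comment> \<open>As \<gamma> is not \<open>Zero\<close>, removing it leaves the formula of the
      axiom in place.\<close>
    using nonzero by (intro weakening_left[OF CHC.ax_zero]) auto
next
  case ax_one
  show ?case
    by (rule weakening_left[OF CHC.ax_one]) auto
next
  case (weak_l \<Delta> \<Pi> \<alpha>)
  show ?case
    by (rule weakening_left[OF weak_l.IH]) auto
next
  case (weak_r \<Delta> \<alpha>)
  then show ?case by (intro CHC.weak_r)
next
  case (cut \<Delta> \<alpha> \<Delta>' \<Pi>)
  then show ?case by simp
next
  case (conj_l1 \<alpha> \<Delta> \<Pi> \<beta>)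
  let ?\<Theta> = "\<Gamma> |\<union>| (\<Delta> |-| {|\<gamma>|})"
  have p: "CHC False (finsert \<alpha> ?\<Theta>) \<Pi>"
    by (rule weakening_left[OF conj_l1.IH]) auto
  show ?case
  proof (cases "Conj \<alpha> \<beta> = \<gamma>")
    case True
    with p show ?thesis using conj[of \<alpha> \<beta> ?\<Theta> \<Pi>] by auto
  next
    case False
    then show ?thesis
      by (intro weakening_left[OF CHC.conj_l1[OF p, of \<beta>]]) auto
  qed
next
  case (conj_l2 \<beta> \<Delta> \<Pi> \<alpha>)
  let ?\<Theta> = "\<Gamma> |\<union>| (\<Delta> |-| {|\<gamma>|})"
  have p: "CHC False (finsert \<beta> ?\<Theta>) \<Pi>"
    by (rule weakening_left[OF conj_l2.IH]) auto
  show ?case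
  proof (cases "Conj \<alpha> \<beta> = \<gamma>")
    case True
    with p show ?thesis using conj[of \<alpha> \<beta> ?\<Theta> \<Pi>] by auto
  next
    case False
    then show ?thesis
      by (intro weakening_left[OF CHC.conj_l2[OF p, of \<alpha>]]) auto
  qed
next
  case (conj_r \<Delta> \<alpha> \<beta>)
  then show ?case by (intro CHC.conj_r)
next
  case (disj_r1 \<Delta> \<alpha> \<beta>)
  then show ?case by (intro CHC.disj_r1)
next
  case (disj_r2 \<Delta> \<beta> \<alpha>)
  then show ?case by (intro CHC.disj_r2)
next
  case (disj_l \<alpha> \<Delta> \<Pi> \<beta>)
  let ?\<Theta> = "\<Gamma> |\<union>| (\<Delta> |-| {|\<gamma>|})"
  have p: "CHC False (finsert \<alpha> ?\<Theta>) \<Pi>"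
    by (rule weakening_left[OF disj_l.IH(1)]) auto
  have q: "CHC False (finsert \<beta> ?\<Theta>) \<Pi>"
    by (rule weakening_left[OF disj_l.IH(2)]) auto
  show ?case
  proof (cases "Disj \<alpha> \<beta> = \<gamma>")
    case True
    with p q show ?thesis using disj[of \<alpha> \<beta> ?\<Theta> \<Pi>] by auto
  next
    case False
    then show ?thesis
      by (intro weakening_left[OF CHC.disj_l[OF p q]]) auto
  qed
next
  case (imp_la \<Delta> \<alpha> \<beta> \<Delta>' \<Pi>)
  let ?\<Theta> = "\<Gamma> |\<union>| ((\<Delta>' |\<union>| \<Delta>) |-| {|\<gamma>|})"
  have p: "CHC False ?\<Theta> (Some \<alpha>)"
    by (rule weakening_left[OF imp_la.IH(1)]) auto
  have q: "CHC False (finsert \<beta> ?\<Theta>) \<Pi>"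
    by (rule weakening_left[OF imp_la.IH(2)]) auto
  show ?case
  proof (cases "Imp \<alpha> \<beta> = \<gamma>")
    case True
    with p q show ?thesis using imp_a[of \<alpha> \<beta> ?\<Theta> \<Pi>] by auto
  next
    case False
    then show ?thesis
      by (intro weakening_left[OF imp_la_same_context[OF p q]]) auto
  qed
next
  case (imp_lb \<alpha> \<Delta> \<beta> \<Delta>')
  let ?\<Theta> = "\<Gamma> |\<union>| ((\<Delta> |\<union>| \<Delta>') |-| {|\<gamma>|})"
  have p: "CHC False (finsert (Neg \<alpha>) ?\<Theta>) (Some \<beta>)"
    by (rule weakening_left[OF imp_lb.IH(1)]) auto
  have q: "CHC False (finsert \<alpha> (finsert \<beta> ?\<Theta>)) None"
    by (rule weakening_left[OF imp_lb.IH(2)]) auto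
  consider "Imp \<alpha> \<beta> \<noteq> \<gamma>" | "Imp \<alpha> \<beta> = \<gamma>" "\<beta> = Zero" | "Imp \<alpha> \<beta> = \<gamma>" "\<beta> \<noteq> Zero"
    by blast
  then show ?case
  proof cases
    case 1
    then show ?thesis
      by (intro weakening_left[OF imp_lb_same_context[OF p q]]) auto
  next
    case 2
    \<comment> \<open>Here \<gamma> is \<open>Neg \<alpha>\<close>, the very formula added to the
      first premise. The induction hypothesis has already cut it away there, leaving
      \<open>Zero\<close> in the stoup.\<close>
    then have "CHC False (\<Gamma> |\<union>| (finsert \<gamma> \<Delta> |-| {|\<gamma>|})) None"
      using stoup_Zero_elim imp_lb.IH(1) by blast
    then show ?thesis by (rule weakening_left) auto
  next
    case 3
    with p q show ?thesis using imp_b[of \<alpha> \<beta> ?\<Theta>] by auto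
  qed
next
  case (imp_r \<alpha> \<Delta> \<beta> \<Delta>')
  let ?\<Theta> = "\<Gamma> |\<union>| ((\<Delta> |\<union>| \<Delta>') |-| {|\<gamma>|})"
  show ?case
  proof (rule imp_r_same_context)
    show "CHC False (finsert \<alpha> ?\<Theta>) (Some \<beta>)"
      by (rule weakening_left[OF imp_r.IH(1)]) auto
    show "CHC False (finsert (Neg \<alpha>) (finsert \<beta> ?\<Theta>)) None"
      by (rule weakening_left[OF imp_r.IH(2)]) auto
  qed
qed

text \<open>Deleting \<gamma> from \<Delta> outright, as in Gentzen's mix, deals with contexts that
  retain a principal formula: the induction hypothesis in \<open>cut_permute_right\<close> removes
  that copy as well.\<close>

lemma cut_permute_left:
  fixes \<gamma> :: "'v fm"
  assumes "CHC False \<Gamma> (Some \<gamma>)"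
    and lighter: "\<And>\<delta> :: 'v fm. weight \<delta> < weight \<gamma> \<Longrightarrow> cut_admissible \<delta>"
    and right: "CHC False \<Delta> \<Pi>"
  shows "CHC False (\<Gamma> |\<union>| (\<Delta> |-| {|\<gamma>|})) \<Pi>"
  using assms(1)
proof (induction \<Gamma> "Some \<gamma>" rule: CHC.induct)
  case ax_id
  show ?case by (rule weakening_left[OF right]) auto
next
  case ax_one
  show ?case
    \<comment> \<open>\<open>One\<close> has no left rule, so the conditions on principal cases are
      vacuous.\<close>
    by (rule cut_permute_right[OF right]) (auto simp flip: ax_one.hyps intro: CHC.ax_one)
next
  case (weak_l \<Gamma> \<alpha>)
  show ?case
    by (rule weakening_left[OF weak_l.hyps(2)]) auto
next
  case (weak_r \<Gamma>)
  show ?case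
    \<comment> \<open>The premise has an empty stoup, so it yields any \<Pi> without a cut.\<close>
    by (rule weakening_left[OF weakening_right[OF weak_r.hyps(1)]]) auto
next
  case cut
  then show ?case by simp
next
  case (conj_l1 \<alpha> \<Gamma> \<beta>)
  then show ?case using CHC.conj_l1 by fastforce
next
  case (conj_l2 \<beta> \<Gamma> \<alpha>)
  then show ?case using CHC.conj_l2 by fastforce
next
  case (conj_r \<Gamma> \<alpha> \<beta>)
  have cuts: "cut_admissible \<alpha>" "cut_admissible \<beta>"
    using conj_r.hyps by (auto intro!: lighter)
  have "CHC False \<Gamma> (Some \<gamma>)"
    using conj_r.hyps CHC.conj_r by metis
  then show ?case
  proof (rule cut_permute_right[OF right])
    fix a b \<Theta> \<Pi>
    assume eq: "\<gamma> = Conj a b" and sub: "\<Gamma> |\<subseteq>| \<Theta>"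
      and p: "CHC False (finsert a \<Theta>) \<Pi> \<or> CHC False (finsert b \<Theta>) \<Pi>"
    have "a = \<alpha>" and "b = \<beta>"
      using eq conj_r.hyps by auto
    with p show "CHC False \<Theta> \<Pi>"
      using cut_admissibleD[OF cuts(1) conj_r.hyps(1) _ sub order_refl]
        cut_admissibleD[OF cuts(2) conj_r.hyps(3) _ sub order_refl] by blast
  qed (use conj_r.hyps in auto)
next
  case (disj_r1 \<Gamma> \<alpha> \<beta>)
  have cuts: "cut_admissible \<alpha>"
    using disj_r1.hyps by (auto intro!: lighter)
  have "CHC False \<Gamma> (Some \<gamma>)"
    using disj_r1.hyps CHC.disj_r1 by metis
  then show ?case
  proof (rule cut_permute_right[OF right])
    fix a b \<Theta> \<Pi>
    assume eq: "\<gamma> = Disj a b" and sub: "\<Gamma> |\<subseteq>| \<Theta>" and p: "CHC False (finsert a \<Theta>) \<Pi>"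
    have "a = \<alpha>"
      using eq disj_r1.hyps by auto
    with p show "CHC False \<Theta> \<Pi>"
      using cut_admissibleD[OF cuts disj_r1.hyps(1) _ sub order_refl] by blast
  qed (use disj_r1.hyps in auto)
next
  case (disj_r2 \<Gamma> \<beta> \<alpha>)
  have cuts: "cut_admissible \<beta>"
    using disj_r2.hyps by (auto intro!: lighter)
  have "CHC False \<Gamma> (Some \<gamma>)"
    using disj_r2.hyps CHC.disj_r2 by metis
  then show ?case
  proof (rule cut_permute_right[OF right])
    fix a b \<Theta> \<Pi>
    assume eq: "\<gamma> = Disj a b" and sub: "\<Gamma> |\<subseteq>| \<Theta>" and p: "CHC False (finsert b \<Theta>) \<Pi>"
    have "b = \<beta>"
      using eq disj_r2.hyps by auto
    with p show "CHC False \<Theta> \<Pi>"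
      using cut_admissibleD[OF cuts disj_r2.hyps(1) _ sub order_refl] by blast
  qed (use disj_r2.hyps in auto)
next
  case (disj_l \<alpha> \<Gamma> \<beta>)
  then show ?case using CHC.disj_l by fastforce
next
  case (imp_la \<Gamma> \<alpha> \<beta> \<Gamma>')
  \<comment> \<open>Only the second premise has \<gamma> in its stoup, so the cut moves up there
    alone.\<close>
  have "CHC False (finsert \<beta> (\<Gamma>' |\<union>| (\<Delta> |-| {|\<gamma>|}))) \<Pi>"
    using imp_la by simp
  from CHC.imp_la[OF imp_la.hyps(1) this] show ?case
    by (rule weakening_left) auto
next
  case (imp_r \<alpha> \<Gamma>\<^sub>1 \<beta> \<Gamma>\<^sub>2)
  let ?\<Gamma> = "\<Gamma>\<^sub>1 |\<union>| \<Gamma>\<^sub>2"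
  have \<gamma>: "\<gamma> = Imp \<alpha> \<beta>"
    using imp_r.hyps by simp
  have cut\<alpha>: "cut_admissible \<alpha>" and cut\<beta>: "cut_admissible \<beta>"
    by (auto simp: \<gamma> intro!: lighter)
  have "CHC False ?\<Gamma> (Some \<gamma>)"
    using imp_r.hyps CHC.imp_r by metis
  then show ?case
  proof (rule cut_permute_right[OF right])
    fix a b \<Theta> \<Pi>
    assume eq: "\<gamma> = Imp a b" and sub: "?\<Gamma> |\<subseteq>| \<Theta>"
      and p: "CHC False \<Theta> (Some a)" and q: "CHC False (finsert b \<Theta>) \<Pi>"
    \<comment> \<open>Against \<open>imp_la\<close> the reduction is the intuitionistic one: the
      first premise of \<open>imp_r\<close> is cut on \<beta>, then the result on \<alpha>.\<close>
    have "CHC False (finsert \<alpha> \<Theta>) \<Pi>"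
      by (rule cut_admissibleD[OF cut\<beta> imp_r.hyps(1)]) (use eq \<gamma> sub q in auto)
    then show "CHC False \<Theta> \<Pi>"
      using cut_admissibleD[OF cut\<alpha> _ _ order_refl order_refl] p eq \<gamma> by blast
  next
    fix a b \<Theta>
    assume eq: "\<gamma> = Imp a b" and "b \<noteq> Zero" and sub: "?\<Gamma> |\<subseteq>| \<Theta>"
      and p: "CHC False (finsert (Neg a) \<Theta>) (Some b)"
      and q: "CHC False (finsert a (finsert b \<Theta>)) None"
    \<comment> \<open>\<open>Neg \<alpha>\<close> is lighter than \<gamma> because \<beta>, not
      being \<open>Zero\<close>, has positive weight.\<close>
    then have ab: "a = \<alpha>" "b = \<beta>" and "cut_admissible (Neg \<alpha>)"
      using \<gamma> by (auto intro!: lighter gr0I)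
    have "CHC False (finsert \<beta> (finsert \<alpha> \<Theta>)) None"
      using q ab by (simp add: finsert_commute)
    \<comment> \<open>First cut on \<beta>: first premise of \<open>imp_r\<close> against second
      premise of \<open>imp_lb\<close>.\<close>
    then have "CHC False (finsert \<alpha> \<Theta>) None"
      by (rule cut_admissibleD[OF cut\<beta> imp_r.hyps(1)]) (use sub in auto)
    then have "CHC False \<Theta> (Some (Neg \<alpha>))"
      by (rule Neg_right)
    moreover have "CHC False (finsert \<beta> (finsert (Neg \<alpha>) \<Gamma>\<^sub>2)) None"
      using imp_r.hyps(3) by (simp add: finsert_commute)
    \<comment> \<open>Second cut on \<beta>, with the roles exchanged: first premise of
      \<open>imp_lb\<close> against second premise of \<open>imp_r\<close>.\<close>
    then have "CHC False (finsert (Neg \<alpha>) \<Theta>) None"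
      by (rule cut_admissibleD[OF cut\<beta> p[unfolded ab]]) (use sub in auto)
    ultimately show "CHC False \<Theta> None"
      using cut_admissibleD[OF \<open>cut_admissible (Neg \<alpha>)\<close>] by blast
  qed (auto simp: \<gamma>)
qed

section \<open>Cut elimination\<close>

lemma cut_admissible: "cut_admissible \<gamma>"
proof (induction \<gamma> rule: measure_induct_rule[of weight])
  case (less \<gamma>)
  show ?case
    unfolding cut_admissible_def
  proof (intro allI impI)
    fix \<Gamma> \<Pi>
    assume "CHC False \<Gamma> (Some \<gamma>)" and "CHC False (finsert \<gamma> \<Gamma>) \<Pi>"
    then have "CHC False (\<Gamma> |\<union>| (finsert \<gamma> \<Gamma> |-| {|\<gamma>|})) \<Pi>"
      using cut_permute_left less by blast
    then show "CHC False \<Gamma> \<Pi>"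
      by (rule weakening_left) auto
  qed
qed

theorem theorem4p11:
  fixes \<Gamma> :: "'v fm fset" and \<Pi> :: "'v fm option"
  assumes "CHC_derivable \<Gamma> \<Pi>"
  shows "CHC_cut_free \<Gamma> \<Pi>"
  using assms
proof (induction rule: CHC.induct)
  case (cut \<Gamma> \<alpha> \<Delta> \<Pi>)
  \<comment> \<open>The induction hypotheses supply cut-free premises, so uppermost cuts are removed
    first.\<close>
  from cut_admissible cut.IH show ?case
    by (rule cut_admissibleD) auto
qed (auto intro: CHC.intros)

end
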